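(* Let $i$ be a node of the network. The transfer functions from node $i$ to its out-neighbors $N_i^+$ can generically all be identified from $CT^0$ if and only if there exist vertex-disjoint directed paths leaving all out-neighbors of $i$ and arriving at the measured nodes defined by $C$ (i.e. one path starting at each out-neighbor of $i$, each ending at a measured node, the paths being mutually vertex disjoint, where the vertex-disjointness condition applies also to the departure and arrival nodes).
   Context: Network. There are $L$ nodes with signals $w(t)=[w_1(t),\dots,w_L(t)]^T$ obeying $w(t)=G^0(q)w(t)+r(t)+v(t)$, where $q^{-1}$ is the delay operator, $r(t)$ is a vector of known external excitation signals (one at each node), $v(t)$ is a noise vector, and the network matrix $G^0$ is an $L\times L$ matrix with zero diagonal whose entries are proper rational transfer functions; the network is well-posed ($(I-G^0)^{-1}$ is proper and stable). $T^0=(I-G^0)^{-1}$. Topology. The topology is a known weakly connected directed graph on $\{1,\dots,L\}$ without self-loops; an edge $(j,i)$ from $j$ to $i$ corresponds to a transfer function $G_{ij}$ that is not known to be zero. A matrix $M$ is consistent with the graph if $M_{ij}\neq 0$ only if $(j,i)$ is an edge (an edge does not force $M_{ij}\ne0$). $G^0$ is consistent with its graph. $N_i^+$ is the set of nodes $j$ such that $(i,j)$ is an edge. Measurements. $y(t)=Cw(t)$, where $C$ is a $p\times L$ matrix each row of which has one entry $1$ and all others $0$; the measured nodes are the $p$ nodes selected by $C$. The matrix $CT^0$ is assumed exactly known. Generic identifiability. A rational transfer matrix parametrization consistent with the graph: for every edge $(j,i)$ fix nonnegative integers $p_{ij},n_{ij}$ and set $$G_{ij}(z)=\kappa_{ij}z^{-p_{ij}}\frac{z^{n_{ij}}+\beta_{ij}^{(n_{ij}-1)}z^{n_{ij}-1}+\dots+\beta_{ij}^{(0)}}{z^{n_{ij}}+\alpha_{ij}^{(n_{ij}-1)}z^{n_{ij}-1}+\dots+\alpha_{ij}^{(0)}}$$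 with real parameters $\kappa_{ij},\alpha_{ij}^{(m)},\beta_{ij}^{(m)}$, and $G_{ij}(z)=0$ when $(j,i)$ is not an edge. All parameters are collected in $P\in\mathbb{R}^N$, and the resulting matrix is $G(P,z)$. A group of edges (or their transfer functions) is generically identifiable from $CT^0$ if for every such parametrization, for all $P$ except possibly those in a zero-measure subset of $\mathbb{R}^N$, the following holds: for every network matrix $\tilde G(z)$ consistent with the graph, $C(I-G(P,z))^{-1}=C(I-\tilde G(z))^{-1}$ implies $G_{ji}(P,z)=\tilde G_{ji}(z)$ for every edge $(i,j)$ of the group. Paths. A walk is a sequence of adjacent directed edges (including trivial walks consisting of one node and no edge). A path is a walk that never passes twice through the same node. Paths are mutually vertex disjoint if no two of them contain a common vertex. *)

theory Defs
  imports
    "HOL-Analysis.Analysis"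
    "HOL-Computational_Algebra.Computational_Algebra"
    "HOL-Computational_Algebra.Field_as_Ring"
    "Graph_Theory.Graph_Theory"
begin

unbundle no fps_syntax

section \<open>Rational transfer functions and network matrices\<close>

text \<open>
  A transfer function is a formal fraction of real polynomials in the forward shift variable \<open>z\<close>
  (the inverse of the delay).  The nodes of the network are the elements of a finite type, and
  entry \<open>G $ i $ j\<close> is the transfer function from node \<open>j\<close> to node \<open>i\<close>, hence it belongs to
  the edge \<open>(j, i)\<close>.
\<close>

type_synonym transfer_function = "real poly fract"
type_synonym 'n transfer_matrix = "transfer_function ^ 'n ^ 'n"

definition proper :: "transfer_function \<Rightarrow> bool" where
  "proper f \<longleftrightarrow> degree (fst (quot_of_fract f)) \<le> degree (snd (quot_of_fract f))"

text \<open>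
  The function \<open>quot_of_fract\<close> yields a numerator and a denominator without common factor, so the
  poles are the complex zeros of that denominator.  Stability is in discrete time.
\<close>

definition stable :: "transfer_function \<Rightarrow> bool" where
  "stable f \<longleftrightarrow>
     (\<forall>z::complex. poly (map_poly complex_of_real (snd (quot_of_fract f))) z = 0 \<longrightarrow> norm z < 1)"

definition network_matrix :: "'n::finite transfer_matrix \<Rightarrow> bool" where
  "network_matrix G \<longleftrightarrow> (\<forall>i. G $ i $ i = 0) \<and> (\<forall>i j. proper (G $ i $ j))"

definition well_posed :: "'n::finite transfer_matrix \<Rightarrow> bool" where
  "well_posed G \<longleftrightarrow> invertible (mat 1 - G) \<and>
     (\<forall>i j. proper (matrix_inv (mat 1 - G) $ i $ j) \<and> stable (matrix_inv (mat 1 - G) $ i $ j))"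


section \<open>Topology and measurements\<close>

definition network_graph :: "'n::finite pair_pre_digraph \<Rightarrow> bool" where
  "network_graph D \<longleftrightarrow>
     pair_digraph D \<and> pverts D = UNIV \<and> Digraph_Component.connected (with_proj D)"

definition consistent :: "'n pair_pre_digraph \<Rightarrow> 'n::finite transfer_matrix \<Rightarrow> bool" where
  "consistent D M \<longleftrightarrow> (\<forall>i j. M $ i $ j \<noteq> 0 \<longrightarrow> (j, i) \<in> parcs D)"

definition out_neighbours :: "'n pair_pre_digraph \<Rightarrow> 'n \<Rightarrow> 'n set" where
  "out_neighbours D i = {j. (i, j) \<in> parcs D}"

definition selection_matrix :: "transfer_function ^ 'n::finite ^ 'p::finite \<Rightarrow> bool" where
  "selection_matrix C \<longleftrightarrow> (\<forall>r. \<exists>i. \<forall>j. C $ r $ j = (if j = i then 1 else 0))"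

definition measured_nodes :: "transfer_function ^ 'n::finite ^ 'p::finite \<Rightarrow> 'n set" where
  "measured_nodes C = {j. \<exists>r. C $ r $ j = 1}"

text \<open>
  The index \<open>j\<close> ranges over a set, so that distinct elements of \<open>A\<close> are assigned paths without
  any common vertex, end points included.  A path may consist of a single vertex.
\<close>

definition vertex_disjoint_paths :: "'n pair_pre_digraph \<Rightarrow> 'n set \<Rightarrow> 'n set \<Rightarrow> bool" where
  "vertex_disjoint_paths D A B \<longleftrightarrow>
     (\<exists>\<pi>. (\<forall>j\<in>A. vpath (\<pi> j) (with_proj D) \<and> hd (\<pi> j) = j \<and> last (\<pi> j) \<in> B) \<and>
          disjoint_family_on (\<lambda>j. set (\<pi> j)) A)"


section \<open>Parametrizations and generic identifiability\<close>

text \<open>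
  A parametrization is given by the delays \<open>d e\<close> and the orders \<open>n e\<close> of the edges \<open>e\<close>.  Only the
  values of \<open>d\<close> and \<open>n\<close> on the edges of the graph matter.
\<close>

datatype 'n param =
    Gain "'n \<times> 'n"
  | Num_Coeff "'n \<times> 'n" nat
  | Den_Coeff "'n \<times> 'n" nat

definition params :: "'n pair_pre_digraph \<Rightarrow> ('n \<times> 'n \<Rightarrow> nat) \<Rightarrow> 'n param set" where
  "params D n = (\<Union>e\<in>parcs D. {Gain e} \<union> Num_Coeff e ` {..<n e} \<union> Den_Coeff e ` {..<n e})"

definition monic_poly :: "nat \<Rightarrow> (nat \<Rightarrow> real) \<Rightarrow> real poly" where
  "monic_poly k c = monom 1 k + (\<Sum>m<k. monom (c m) m)"

definition parametrized_matrix ::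
  "'n pair_pre_digraph \<Rightarrow> ('n \<times> 'n \<Rightarrow> nat) \<Rightarrow> ('n \<times> 'n \<Rightarrow> nat) \<Rightarrow> ('n param \<Rightarrow> real)
     \<Rightarrow> 'n::finite transfer_matrix" where
  "parametrized_matrix D d n P = (\<chi> i j. let e = (j, i) in
     if e \<in> parcs D then
       Fract [:P (Gain e):] (monom 1 (d e)) *
       Fract (monic_poly (n e) (\<lambda>m. P (Num_Coeff e m))) (monic_poly (n e) (\<lambda>m. P (Den_Coeff e m)))
     else 0)"

text \<open>
  The real vector \<open>P\<close> of all parameters is a function on the finite set \<open>params D n\<close>, with the
  product Lebesgue measure.  The set \<open>\<G>\<close> is the class of candidate network matrices, and \<open>S\<close> is
  the group of edges; the class is a parameter because candidates may or may not be required to be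
  well-posed, like the true network, beyond invertibility of \<open>I - G'\<close>.  For a null set of parameters \<open>P\<close>, the inverse on the left-hand side does
  not exist; the value of \<open>matrix_inv\<close> on a singular matrix is therefore irrelevant there.
\<close>

definition generically_identifiable ::
  "'n transfer_matrix set \<Rightarrow> 'n pair_pre_digraph \<Rightarrow> transfer_function ^ 'n::finite ^ 'p::finite
     \<Rightarrow> ('n \<times> 'n) set \<Rightarrow> bool" where
  "generically_identifiable \<G> D C S \<longleftrightarrow>
     (\<forall>d n. AE P in Pi\<^sub>M (params D n) (\<lambda>_. lborel).
        \<forall>G'\<in>\<G>. consistent D G' \<longrightarrow>
          C ** matrix_inv (mat 1 - parametrized_matrix D d n P) = C ** matrix_inv (mat 1 - G') \<longrightarrow>
          (\<forall>(i, j)\<in>S. parametrized_matrix D d n P $ j $ i = G' $ j $ i))"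

end

theory Submission
  imports Defs
begin

text \<open>
  Put \<open>T = (I - G)\<inverse>\<close>, let \<open>A\<close> be the set of out-neighbours of \<open>i\<close> and \<open>B\<close> the set of measured
  nodes.  Equality of \<open>C T\<close> and \<open>C T'\<close> means \<open>C T (G - G') = 0\<close>, so the transfer functions leaving
  \<open>i\<close> are determined iff \<open>C T x = 0\<close> has no nonzero solution \<open>x\<close> supported on \<open>A\<close>.  In terms of
  \<open>u = T x\<close> this says: \<open>(I - G) u = 0\<close> off \<open>A\<close> and \<open>u = 0\<close> on \<open>B\<close> force \<open>u = 0\<close>.  Hence it holds
  iff, for some \<open>\<sigma>\<close> from \<open>A\<close> to \<open>B\<close>, replacing the rows \<open>a \<in> A\<close> of \<open>I - G\<close> by the unit vectors
  of \<open>\<sigma> a\<close> gives an invertible matrix.  A nonzero term of the Leibniz expansion of its determinant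
  is a system of disjoint paths, which replaces any appeal to Menger's theorem.  Conversely such a
  system makes the determinant a nonzero polynomial in the parameters.  For the
  necessity of the paths it is enough to refute identifiability for the parametrization by constant
  matrices, whose networks are automatically proper and stable.
\<close>

unbundle no Formal_Power_Series.fps_syntax  \<comment> \<open>the short name denotes the Laurent series bundle\<close>

subsection \<open>Zero sets of polynomial functions\<close>

text \<open>Generation by the ring operations lets measurability and restriction to one coordinate
  be proved by induction, without formal multivariate polynomials.\<close>

inductive polynomial_on :: "'a set \<Rightarrow> (('a \<Rightarrow> real) \<Rightarrow> real) \<Rightarrow> bool" for S where
  const: "polynomial_on S (\<lambda>_. c)"
| coord: "x \<in> S \<Longrightarrow> polynomial_on S (\<lambda>P. P x)"
| add: "polynomial_on S f \<Longrightarrow> polynomial_on S g \<Longrightarrow> polynomial_on S (\<lambda>P. f P + g P)"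
| mult: "polynomial_on S f \<Longrightarrow> polynomial_on S g \<Longrightarrow> polynomial_on S (\<lambda>P. f P * g P)"

lemma polynomial_on_diff:
  assumes "polynomial_on S f" "polynomial_on S g"
  shows "polynomial_on S (\<lambda>P. f P - g P)"
  using polynomial_on.add[OF assms(1) polynomial_on.mult[OF polynomial_on.const[of S "-1"] assms(2)]]
  by simp

lemma polynomial_on_sum:
  assumes "\<And>x. x \<in> A \<Longrightarrow> polynomial_on S (f x)"
  shows "polynomial_on S (\<lambda>P. \<Sum>x\<in>A. f x P)"
  using assms
  by (induction A rule: infinite_finite_induct) (auto intro: polynomial_on.intros)

lemma polynomial_on_prod:
  assumes "\<And>x. x \<in> A \<Longrightarrow> polynomial_on S (f x)"
  shows "polynomial_on S (\<lambda>P. \<Prod>x\<in>A. f x P)"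
  using assms
  by (induction A rule: infinite_finite_induct) (auto intro: polynomial_on.intros)

lemma polynomial_on_det:
  fixes M :: "('a \<Rightarrow> real) \<Rightarrow> real ^ 'n ^ 'n"
  assumes "\<And>i j. polynomial_on S (\<lambda>P. M P $ i $ j)"
  shows "polynomial_on S (\<lambda>P. det (M P))"
  unfolding det_def
  by (intro polynomial_on_sum polynomial_on_prod polynomial_on.mult polynomial_on.const assms)

lemma polynomial_on_cong:
  assumes "polynomial_on S f" "\<And>x. x \<in> S \<Longrightarrow> P x = Q x"
  shows "f P = f Q"
  using assms by induction auto

lemma polynomial_on_update:
  assumes "polynomial_on (insert x S) f"
  shows "polynomial_on S (\<lambda>P. f (P(x := t)))"
  using assms
proof induction
  case (coord y)
  then show ?case by (cases "y = x") (auto intro: polynomial_on.intros)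
qed (auto intro: polynomial_on.intros)

lemma polynomial_on_univariate:
  assumes "polynomial_on S f"
  shows "\<exists>q. \<forall>t. f (P(x := t)) = poly q t"
  using assms
proof induction
  case (const c)
  show ?case by (rule exI[of _ "[:c:]"]) simp
next
  case (coord y)
  show ?case
    by (cases "y = x") (auto intro: exI[of _ "[:0, 1:]"] exI[of _ "[:P y:]"])
next
  case (add f g)
  then obtain q r where "\<forall>t. f (P(x := t)) = poly q t" "\<forall>t. g (P(x := t)) = poly r t"
    by blast
  then show ?case by (intro exI[of _ "q + r"]) (simp del: fun_upd_apply)
next
  case (mult f g)
  then obtain q r where "\<forall>t. f (P(x := t)) = poly q t" "\<forall>t. g (P(x := t)) = poly r t"
    by blast
  then show ?case by (intro exI[of _ "q * r"]) (simp del: fun_upd_apply)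
qed

lemma polynomial_on_measurable:
  assumes "polynomial_on S f"
  shows "f \<in> borel_measurable (Pi\<^sub>M S (\<lambda>_. lborel))"
  using assms
proof induction
  case (coord x)
  have "(\<lambda>P. P x) \<in> measurable (Pi\<^sub>M S (\<lambda>_. lborel :: real measure)) lborel"
    by (rule measurable_component_singleton[OF coord])
  then show ?case by simp
qed auto

text \<open>Fubini and induction on the coordinates: with \<open>x\<close> frozen at
  \<open>P0 x\<close>, the function is nonzero for almost all values of the others; there it is a
  nonzero polynomial in \<open>x\<close>, with finitely many roots.\<close>

lemma polynomial_on_AE_nonzero:
  assumes "finite S" "polynomial_on S f" "f P0 \<noteq> 0"
  shows "AE P in Pi\<^sub>M S (\<lambda>_. lborel). f P \<noteq> 0"
  using assms
proof (induction S arbitrary: f rule: finite_induct)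
  case empty
  have "f P = f P0" for P
    by (rule polynomial_on_cong[OF empty(1)]) simp
  with empty(2) have "f P \<noteq> 0" for P by metis
  then show ?case by simp
next
  case (insert x S)
  interpret product_sigma_finite "\<lambda>_::'a. lborel :: real measure"
    by standard
  let ?M = "Pi\<^sub>M S (\<lambda>_. lborel :: real measure)"
  let ?M' = "Pi\<^sub>M (insert x S) (\<lambda>_. lborel :: real measure)"
  have f: "f \<in> borel_measurable ?M'"
    by (rule polynomial_on_measurable[OF insert.prems(1)])
  have "AE P in ?M. f (P(x := P0 x)) \<noteq> 0"
    using insert.prems by (intro insert.IH polynomial_on_update) auto
  then have inner: "AE P in ?M. (\<integral>\<^sup>+ t. indicator {Q. f Q = 0} (P(x := t)) \<partial>lborel) = 0"
  proof eventually_elim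
    case (elim P)
    obtain q where q: "\<And>t. f (P(x := t)) = poly q t"
      using polynomial_on_univariate[OF insert.prems(1)] by blast
    with elim have "q \<noteq> 0" by auto
    then have fin: "finite {t. poly q t = 0}" by (rule poly_roots_finite)
    have "(\<integral>\<^sup>+ t. indicator {Q. f Q = 0} (P(x := t)) \<partial>lborel) =
          (\<integral>\<^sup>+ t. indicator {t. poly q t = 0} t \<partial>lborel)"
      by (intro nn_integral_cong) (simp add: q indicator_def)
    also have "\<dots> = 0"
      using fin by (subst nn_integral_indicator) (auto intro: finite_imp_closed borel_closed
          simp: emeasure_lborel_countable countable_finite)
    finally show ?case .
  qed
  have "(\<integral>\<^sup>+ P. indicator {P \<in> space ?M'. \<not> f P \<noteq> 0} P \<partial>?M') =
        (\<integral>\<^sup>+ P. indicator {P. f P = 0} P \<partial>?M')"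
    by (intro nn_integral_cong) (simp add: indicator_def)
  also have "\<dots> = (\<integral>\<^sup>+ P. (\<integral>\<^sup>+ t. indicator {Q. f Q = 0} (P(x := t)) \<partial>lborel) \<partial>?M)"
    using insert.hyps f by (intro product_nn_integral_insert) auto
  also have "\<dots> = (\<integral>\<^sup>+ P. 0 \<partial>?M)"
    using inner by (rule nn_integral_cong_AE)
  finally have "emeasure ?M' {P \<in> space ?M'. f P = 0} = 0"
    using f by simp
  with f show ?case
    by (intro AE_I[of _ _ "{P \<in> space ?M'. f P = 0}"]) auto
qed

subsection \<open>Observability of a set of inputs\<close>

text \<open>
  For \<open>K = I - G\<close> with inverse \<open>T\<close>, the columns \<open>A\<close> of the rows \<open>B\<close> of \<open>T\<close> are linearly
  independent: \<open>u = T x\<close> with \<open>x\<close> supported on \<open>A\<close>.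
\<close>

definition inputs_observable :: "'a::comm_ring_1 ^ 'n ^ 'n \<Rightarrow> 'n set \<Rightarrow> 'n set \<Rightarrow> bool" where
  "inputs_observable K A B \<longleftrightarrow>
     (\<forall>u. (\<forall>j. j \<notin> A \<longrightarrow> (K *v u) $ j = 0) \<and> (\<forall>b\<in>B. u $ b = 0) \<longrightarrow> u = 0)"

text \<open>Turns the conditions \<open>u $ \<sigma> a = 0\<close> into rows of a square system, so
  that a determinant can test observability.\<close>

definition replace_rows :: "'n set \<Rightarrow> ('n \<Rightarrow> 'n) \<Rightarrow> 'a::comm_ring_1 ^ 'n ^ 'n \<Rightarrow> 'a ^ 'n ^ 'n" where
  "replace_rows A \<sigma> K = (\<chi> j k. if j \<in> A then (if k = \<sigma> j then 1 else 0) else K $ j $ k)"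

lemma replace_rows_mult_vec:
  "(replace_rows A \<sigma> K *v u) $ j = (if j \<in> A then u $ \<sigma> j else (K *v u) $ j)"
proof -
  have "(\<Sum>k\<in>UNIV. (if k = \<sigma> j then 1 else 0) * u $ k) = u $ \<sigma> j"
    by (subst sum.cong[OF refl, of _ _ "\<lambda>k. if k = \<sigma> j then u $ k else 0"]) auto
  then show ?thesis
    by (simp add: matrix_vector_mult_def replace_rows_def)
qed

lemma det_nz_iff_kernel:
  fixes M :: "'a::field ^ 'n ^ 'n"
  shows "det M \<noteq> 0 \<longleftrightarrow> (\<forall>u. M *v u = 0 \<longrightarrow> u = 0)"
  by (metis invertible_det_nz invertible_left_inverse matrix_left_invertible_ker)

lemma inputs_observable_if_det_nz:
  fixes K :: "'a::field ^ 'n ^ 'n"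
  assumes "\<sigma> ` A \<subseteq> B" "det (replace_rows A \<sigma> K) \<noteq> 0"
  shows "inputs_observable K A B"
  unfolding inputs_observable_def
proof (intro allI impI)
  fix u assume u: "(\<forall>j. j \<notin> A \<longrightarrow> (K *v u) $ j = 0) \<and> (\<forall>b\<in>B. u $ b = 0)"
  have "replace_rows A \<sigma> K *v u = 0"
    using u assms(1) by (auto simp: vec_eq_iff replace_rows_mult_vec)
  then show "u = 0"
    using assms(2) det_nz_iff_kernel by blast
qed

text \<open>With both sets empty, observability is triviality of the kernel; generic invertibility
  thus becomes a case of generic observability.\<close>

lemma invertible_if_inputs_observable_empty:
  fixes K :: "'a::field ^ 'n ^ 'n"
  assumes "inputs_observable K {} {}"
  shows "invertible K"
  using assms unfolding inputs_observable_def invertible_det_nz det_nz_iff_kernel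
  by auto

text \<open>Serves evaluation at 1, the embedding into fractions and the embedding of constants
  alike.\<close>

lemma det_ring_hom:
  fixes M :: "'a::comm_ring_1 ^ 'n ^ 'n" and h :: "'a \<Rightarrow> 'b::comm_ring_1"
  assumes "h 0 = 0" "h 1 = 1" "\<And>x y. h (x + y) = h x + h y" "\<And>x y. h (x * y) = h x * h y"
  shows "det (\<chi> i j. h (M $ i $ j)) = h (det M)"
proof -
  have sum: "h (sum f S) = (\<Sum>x\<in>S. h (f x))" for f :: "('n \<Rightarrow> 'n) \<Rightarrow> 'a" and S
    by (induction S rule: infinite_finite_induct) (auto simp: assms)
  have prod: "h (prod f S) = (\<Prod>x\<in>S. h (f x))" for f :: "'n \<Rightarrow> 'a" and S
    by (induction S rule: infinite_finite_induct) (auto simp: assms)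
  have neg: "h (- x) = - h x" for x
    using assms(1,3) by (metis add.right_inverse add_eq_0_iff)
  have sgn: "h (of_int (sign p)) = of_int (sign p)" for p :: "'n \<Rightarrow> 'n"
    by (simp add: sign_def assms neg)
  show ?thesis
    by (simp add: det_def sum prod sgn assms)
qed

subsection \<open>Disjoint paths from observability\<close>

text \<open>
  A nonvanishing term of the Leibniz expansion is a permutation of the nodes.  Following its inverse
  from the elements of \<open>A\<close> until \<open>\<sigma> ` A\<close> is reached yields the paths.
\<close>

lemma vertex_disjoint_paths_if_det_nz:
  fixes G :: "'a::idom ^ 'n::finite ^ 'n"
  assumes verts: "pverts D = UNIV"
    and edges: "\<And>j k. G $ j $ k \<noteq> 0 \<Longrightarrow> (k, j) \<in> parcs D"
    and det: "det (replace_rows A \<sigma> (mat 1 - G)) \<noteq> 0"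
    and B: "\<sigma> ` A \<subseteq> B"
  shows "vertex_disjoint_paths D A B"
proof -
  obtain p where p: "p permutes UNIV"
    and nz: "(\<Prod>j\<in>UNIV. replace_rows A \<sigma> (mat 1 - G) $ j $ p j) \<noteq> 0"
    using det unfolding det_def by (metis (mono_tags, lifting) mem_Collect_eq mult_zero_right sum.neutral)
  have nz': "replace_rows A \<sigma> (mat 1 - G) $ j $ p j \<noteq> 0" for j
    using nz by (simp add: prod_zero_iff)
  have pA: "p j = \<sigma> j" if "j \<in> A" for j
    using nz'[of j] that by (auto simp: replace_rows_def split: if_splits)
  \<comment> \<open>Off the diagonal, a nonzero entry of \<open>mat 1 - G\<close> comes from an
    edge, so the inverse of \<open>p\<close> follows edges.\<close>
  have pE: "(p j, j) \<in> parcs D" if "j \<notin> A" "p j \<noteq> j" for j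
    using nz'[of j] that edges[of j "p j"] by (auto simp: replace_rows_def mat_def)
  define q where "q = inv p"
  have q: "q permutes UNIV"
    unfolding q_def by (rule permutes_inv[OF p])
  have pq: "p (q j) = j" for j
    using permutes_inverses(1)[OF p] by (simp add: q_def)
  have inj: "inj (q ^^ k)" for k
    by (rule inj_fn[OF permutes_inj[OF q]])
  \<comment> \<open>The orbit of \<open>a\<close> under \<open>q\<close> is a cycle, and the node
    that precedes \<open>a\<close> on it is \<open>p a = \<sigma> a\<close>.\<close>
  have return: "\<exists>m. (q ^^ m) a \<in> \<sigma> ` A" if "a \<in> A" for a
  proof -
    have "permutation q"
      using q by (auto simp: permutation_permutes)
    then obtain N where N: "(q ^^ N) a = a" "N > 0"
      by (metis permutation_self)
    then obtain m where "N = Suc m" by (metis gr0_implies_Suc)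
    with N(1) have "q ((q ^^ m) a) = a" by simp
    then have "(q ^^ m) a = \<sigma> a"
      using pA[OF that] pq by metis
    then show ?thesis using that by auto
  qed
  define len where "len a = (LEAST m. (q ^^ m) a \<in> \<sigma> ` A)" for a
  have len: "(q ^^ len a) a \<in> \<sigma> ` A" if "a \<in> A" for a
    unfolding len_def using return[OF that] by (rule LeastI_ex)
  have before: "(q ^^ m) a \<notin> \<sigma> ` A" if "m < len a" for a m
    using that unfolding len_def by (rule not_less_Least)
  \<comment> \<open>The node before a member of \<open>A\<close> is its image under
    \<open>\<sigma>\<close>, where the path would already have stopped.\<close>
  have no_return: "(q ^^ Suc m) a \<notin> A" if "m < len a" for a m
  proof
    assume *: "(q ^^ Suc m) a \<in> A"
    then have "(q ^^ m) a = \<sigma> ((q ^^ Suc m) a)"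
      using pA[OF *] pq by simp
    with * before[OF that] show False by blast
  qed
  \<comment> \<open>Cancelling \<open>q ^^ k\<close> turns a shared vertex into a return from
    \<open>a'\<close> to \<open>A\<close>, possible only in zero steps. This yields both
    distinctness and disjointness.\<close>
  have separate: "k = l \<and> a = a'"
    if "a \<in> A" "a' \<in> A" "l \<le> len a'" "k \<le> l" "(q ^^ k) a = (q ^^ l) a'" for a a' k l
  proof -
    have "(q ^^ l) a' = (q ^^ k) ((q ^^ (l - k)) a')"
      using that(4) by (metis comp_apply funpow_add le_add_diff_inverse)
    with that(5) have a: "a = (q ^^ (l - k)) a'"
      using inj[of k] by (metis injD)
    show ?thesis
    proof (cases "l - k")
      case 0
      with a that(4) show ?thesis by simp
    next
      case (Suc m)
      with that(3) have "m < len a'" by linarith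
      from no_return[OF this] Suc a that(1) show ?thesis by simp
    qed
  qed
  have edge: "((q ^^ m) a, (q ^^ Suc m) a) \<in> parcs D" if "a \<in> A" "m < len a" for a m
  proof -
    \<comment> \<open>A fixed point on the orbit would make \<open>a\<close> itself fixed, again a
      return to \<open>A\<close>.\<close>
    have "(q ^^ Suc m) a \<noteq> (q ^^ m) a"
    proof
      assume "(q ^^ Suc m) a = (q ^^ m) a"
      then have "(q ^^ m) (q a) = (q ^^ m) a"
        by (simp add: funpow_swap1)
      then have "q a = a"
        using inj[of m] by (metis injD)
      then have "(q ^^ Suc m) a = a"
        by (induction m) (simp_all add: funpow_swap1)
      with no_return[OF that(2)] that(1) show False by simp
    qed
    then show ?thesis
      using pE[of "(q ^^ Suc m) a"] no_return[OF that(2)] pq by auto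
  qed
  define \<pi> where "\<pi> a = map (\<lambda>m. (q ^^ m) a) [0..<Suc (len a)]" for a
  have arcs: "set (vwalk_arcs (map g [k..<Suc l])) \<subseteq> parcs D"
    if "\<And>m. k \<le> m \<Longrightarrow> m < l \<Longrightarrow> (g m, g (Suc m)) \<in> parcs D" for g :: "nat \<Rightarrow> 'n" and k l
    using that
  proof (induction "l - k" arbitrary: k)
    case 0
    then show ?case by (cases "k = l") auto
  next
    case (Suc d)
    then have "map g [k..<Suc l] = g k # g (Suc k) # map g [Suc (Suc k)..<Suc l]"
      "map g [Suc k..<Suc l] = g (Suc k) # map g [Suc (Suc k)..<Suc l]"
      by (simp_all add: upt_conv_Cons del: upt_Suc)
    moreover have "set (vwalk_arcs (map g [Suc k..<Suc l])) \<subseteq> parcs D"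
      using Suc by (intro Suc.hyps(1)) auto
    ultimately show ?case
      using Suc.prems[of k] Suc.hyps(2) by (auto simp del: upt_Suc)
  qed
  show ?thesis
    unfolding vertex_disjoint_paths_def
  proof (intro exI[of _ \<pi>] conjI ballI)
    fix a assume a: "a \<in> A"
    have "distinct (\<pi> a)"
      unfolding \<pi>_def distinct_map
      by (auto intro!: inj_onI simp del: upt_Suc) (metis a separate nat_le_linear less_Suc_eq_le)
    moreover have "set (vwalk_arcs (\<pi> a)) \<subseteq> parcs D"
      unfolding \<pi>_def by (rule arcs) (use edge a in auto)
    ultimately show "vpath (\<pi> a) (with_proj D)"
      by (auto simp: vpath_def vwalk_def verts \<pi>_def)
    show "hd (\<pi> a) = a"
      by (simp add: \<pi>_def upt_conv_Cons del: upt_Suc)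
    show "last (\<pi> a) \<in> B"
      using len[OF a] B by (auto simp: \<pi>_def)
  next
    show "disjoint_family_on (\<lambda>a. set (\<pi> a)) A"
      unfolding disjoint_family_on_def \<pi>_def
      by (auto simp del: upt_Suc funpow.simps simp: less_Suc_eq_le) (metis separate nat_le_linear)
  qed
qed

text \<open>Exchange argument: the rows outside \<open>A\<close> are independent and, by
  observability, span together with the unit vectors of \<open>B\<close>. Extending them to a basis
  adds exactly \<open>card A\<close> unit vectors, which \<open>\<sigma>\<close> enumerates.\<close>

lemma ex_replace_rows_det_nz:
  fixes K :: "real ^ 'n::finite ^ 'n"
  assumes K: "invertible K" and obs: "inputs_observable K A B"
  obtains \<sigma> where "\<sigma> ` A \<subseteq> B" "det (replace_rows A \<sigma> K) \<noteq> 0"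
proof -
  let ?S = "(\<lambda>j. K $ j) ` (- A)"
  let ?V = "?S \<union> (\<lambda>b. axis b 1) ` B"
  have det: "det K \<noteq> 0"
    using K invertible_det_nz by blast
  have row: "row j K = K $ j" for j
    by (simp add: row_def)
  have inj: "inj (\<lambda>j. K $ j)"
    using det det_identical_rows[of _ _ K] by (auto intro!: injI simp: row)
  have "independent (rows K)"
    using det det_dependent_rows[of K] dependent_vec_eq[of "rows K"] by blast
  then have S: "independent ?S"
    by (rule independent_mono) (auto simp: rows_def row)
  obtain X where X: "?S \<subseteq> X" "X \<subseteq> ?V" "independent X" "?V \<subseteq> span X"
    using maximal_independent_subset_extend[of ?S ?V] S by blast
  \<comment> \<open>The normal of a hyperplane containing \<open>X\<close> would violate
    observability.\<close>
  have span: "span X = UNIV"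
  proof (rule ccontr)
    assume "span X \<noteq> UNIV"
    then obtain a where a: "a \<noteq> 0" "span X \<subseteq> {x. a \<bullet> x = 0}"
      using span_not_univ_subset_hyperplane by blast
    have V: "a \<bullet> x = 0" if "x \<in> ?V" for x
      using a(2) X(4) that by blast
    have "(K *v a) $ j = 0" if "j \<notin> A" for j
      using V[of "K $ j"] that by (simp add: matrix_vector_mul_component inner_commute)
    moreover have "a $ b = 0" if "b \<in> B" for b
      using V[of "axis b 1"] that by (simp add: inner_axis)
    ultimately have "a = 0"
      using obs unfolding inputs_observable_def by blast
    with a(1) show False by blast
  qed
  have fin: "finite X"
    using X(3) independent_imp_finite by blast
  have "card X = CARD('n)"
    using X(3) span dim_eq_full[of X] by (simp add: dim_eq_card_independent)
  moreover have "card ?S = card (- A)"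
    using inj by (intro card_image) (auto simp: inj_on_def)
  moreover have "card (- A) = CARD('n) - card A" "card A \<le> CARD('n)"
    by (simp_all add: Compl_eq_Diff_UNIV card_Diff_subset card_mono)
  ultimately have cardX: "card (X - ?S) = card A"
    using X(1) by (simp add: card_Diff_subset)
  define E where "E = {b \<in> B. axis b (1::real) \<in> X - ?S}"
  have E: "X - ?S = (\<lambda>b. axis b 1) ` E"
    using X(2) by (auto simp: E_def)
  have "card (X - ?S) = card E"
    unfolding E by (intro card_image) (auto simp: inj_on_def axis_eq_axis)
  with cardX obtain \<sigma> where \<sigma>: "bij_betw \<sigma> A E"
    using finite_same_card_bij[of A E] by auto
  \<comment> \<open>A kernel vector is orthogonal to the whole basis \<open>X\<close>.\<close>
  have "u = 0" if u: "replace_rows A \<sigma> K *v u = 0" for u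
  proof -
    have "(if j \<in> A then u $ \<sigma> j else (K *v u) $ j) = 0" for j
      using u replace_rows_mult_vec[of A \<sigma> K u j] by simp
    then have rows: "j \<in> A \<Longrightarrow> u $ \<sigma> j = 0" "j \<notin> A \<Longrightarrow> (K *v u) $ j = 0" for j
      by metis+
    have "u \<bullet> x = 0" if "x \<in> X" for x
    proof (cases "x \<in> ?S")
      case True
      with rows(2) show ?thesis
        by (auto simp: matrix_vector_mul_component inner_commute)
    next
      case False
      then have "x \<in> (\<lambda>b. axis b 1) ` \<sigma> ` A"
        using that E \<sigma> by (auto simp: bij_betw_def)
      with rows(1) show ?thesis
        by (auto simp: inner_axis)
    qed
    then have "span X \<subseteq> {x. u \<bullet> x = 0}"
      by (intro span_minimal subspace_hyperplane) blast
    with span have "u \<bullet> u = 0" by blast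
    then show ?thesis by simp
  qed
  then have "det (replace_rows A \<sigma> K) \<noteq> 0"
    using det_nz_iff_kernel by blast
  moreover have "\<sigma> ` A \<subseteq> B"
    using \<sigma> by (auto simp: bij_betw_def E_def)
  ultimately show thesis
    by (rule that[rotated])
qed

subsection \<open>Generic observability from disjoint paths\<close>

lemma vwalk_arcs_nth:
  "Suc m < length p \<Longrightarrow> (p ! m, p ! Suc m) \<in> set (vwalk_arcs p)"
proof (induction p arbitrary: m rule: vwalk_arcs.induct)
  case (3 x y xs)
  then show ?case by (cases m) auto
qed auto

text \<open>By disjointness, each path vertex after the first has a single incoming edge, so a
  kernel vector is constant along each path; the replaced row makes it 0 at the end. Vertices off
  the paths have no incoming edge.\<close>

lemma det_disjoint_paths_nz:
  fixes \<pi> :: "'n::finite \<Rightarrow> 'n list"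
  assumes path: "\<And>a. a \<in> A \<Longrightarrow> \<pi> a \<noteq> [] \<and> distinct (\<pi> a) \<and> hd (\<pi> a) = a"
    and disj: "disjoint_family_on (\<lambda>a. set (\<pi> a)) A"
    and F: "F = {(k, j). \<exists>a\<in>A. \<exists>m. Suc m < length (\<pi> a) \<and> k = \<pi> a ! m \<and> j = \<pi> a ! Suc m}"
  shows "det (replace_rows A (\<lambda>a. last (\<pi> a))
    (mat 1 - (\<chi> j k. if (k, j) \<in> F then 1 else 0)) :: real ^ 'n ^ 'n) \<noteq> 0"
    (is "det (replace_rows A ?\<sigma> (mat 1 - ?F)) \<noteq> 0")
  unfolding det_nz_iff_kernel
proof (intro allI impI)
  fix u assume "replace_rows A ?\<sigma> (mat 1 - ?F) *v u = 0"
  then have eq: "(if j \<in> A then u $ ?\<sigma> j else ((mat 1 - ?F) *v u) $ j) = 0" for j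
    using replace_rows_mult_vec[of A ?\<sigma> "mat 1 - ?F" u j] by simp
  have rows: "u $ ?\<sigma> j = 0" if "j \<in> A" for j
    using eq[of j] that by simp
  have rows': "u $ j = (?F *v u) $ j" if "j \<notin> A" for j
    using eq[of j] that by (simp add: matrix_vector_mult_diff_rdistrib)
  have mult_F: "(?F *v u) $ j = (\<Sum>k\<in>UNIV. if (k, j) \<in> F then u $ k else 0)" for j
    unfolding matrix_vector_mult_def vec_lambda_beta by (intro sum.cong) simp_all
  have same: "a = b \<and> k = l"
    if "a \<in> A" "b \<in> A" "k < length (\<pi> a)" "l < length (\<pi> b)" "\<pi> a ! k = \<pi> b ! l" for a b k l
  proof -
    have "\<pi> a ! k \<in> set (\<pi> a) \<inter> set (\<pi> b)"
      using that by (metis IntI nth_mem)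
    then have "a = b"
      using disj that(1,2) by (auto simp: disjoint_family_on_def)
    with that path show ?thesis
      by (auto simp: nth_eq_iff_index_eq)
  qed
  have hd: "\<pi> a ! 0 = a" "0 < length (\<pi> a)" if "a \<in> A" for a
    using path[OF that] by (auto simp: hd_conv_nth)
  have step_eq: "u $ (\<pi> a ! Suc m) = u $ (\<pi> a ! m)" if a: "a \<in> A" and m: "Suc m < length (\<pi> a)" for a m
  proof -
    \<comment> \<open>A member of \<open>A\<close> occurs only at position 0 of its own
      path.\<close>
    have "\<pi> a ! Suc m \<notin> A"
      using same[OF a _ m, of "\<pi> a ! Suc m" 0] hd by auto
    then have "u $ (\<pi> a ! Suc m) = (?F *v u) $ (\<pi> a ! Suc m)"
      by (rule rows')
    also have "\<dots> = (\<Sum>k\<in>UNIV. if k = \<pi> a ! m then u $ k else 0)"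
    proof -
      have "(k, \<pi> a ! Suc m) \<in> F \<longleftrightarrow> k = \<pi> a ! m" for k
      proof
        assume "(k, \<pi> a ! Suc m) \<in> F"
        then obtain b l where "b \<in> A" "Suc l < length (\<pi> b)" "k = \<pi> b ! l" "\<pi> a ! Suc m = \<pi> b ! Suc l"
          by (auto simp: F)
        with same[OF a \<open>b \<in> A\<close> m \<open>Suc l < length (\<pi> b)\<close>] show "k = \<pi> a ! m"
          by simp
      next
        assume "k = \<pi> a ! m"
        with a m show "(k, \<pi> a ! Suc m) \<in> F"
          unfolding F by blast
      qed
      then show ?thesis
        by (simp add: mult_F)
    qed
    finally show ?thesis by simp
  qed
  have on_path: "u $ (\<pi> a ! m) = 0" if a: "a \<in> A" and m: "m < length (\<pi> a)" for a m
  proof -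
    have "m \<le> length (\<pi> a) - 1" using m by simp
    then show ?thesis
    proof (induction rule: inc_induct)
      case base
      show ?case using rows[OF a] path[OF a] by (simp add: last_conv_nth)
    next
      case (step l)
      then show ?case using step_eq[OF a, of l] by simp
    qed
  qed
  show "u = 0"
  proof (rule ccontr)
    assume "u \<noteq> 0"
    then obtain j where j: "u $ j \<noteq> 0" by (auto simp: vec_eq_iff)
    have off: "j \<noteq> \<pi> a ! m" if "a \<in> A" "m < length (\<pi> a)" for a m
      using on_path[OF that] j by auto
    then have no_edge: "(k, j) \<notin> F" for k
      by (auto simp: F)
    have "j \<notin> A" using off[of j 0] hd[of j] by auto
    then have "u $ j = (?F *v u) $ j" by (rule rows')
    also have "\<dots> = 0"
      by (simp add: mult_F no_edge)
    finally show False using j by simp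
  qed
qed

lemma inputs_observable_scale:
  fixes K K' :: "'a::comm_ring_1 ^ 'n::finite ^ 'n"
  assumes "inputs_observable K' A B" "\<And>j k. K' $ j $ k = c * K $ j $ k"
  shows "inputs_observable K A B"
proof -
  have "(K' *v u) $ j = c * (K *v u) $ j" for u j
    by (simp add: matrix_vector_mult_def assms(2) sum_distrib_left mult.assoc)
  with assms(1) show ?thesis
    unfolding inputs_observable_def by simp
qed

lemma poly_monic_poly_1: "poly (monic_poly k c) 1 = 1 + (\<Sum>m<k. c m)"
  by (simp add: monic_poly_def poly_monom poly_sum)

lemma monic_poly_nz: "monic_poly k c \<noteq> 0"
proof -
  have "coeff (monic_poly k c) k = 1"
    by (simp add: monic_poly_def coeff_sum)
  then show ?thesis by auto
qed

lemma finite_params: "finite (params D n)"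
  for D :: "'n::finite pair_pre_digraph"
  unfolding params_def by (intro finite_UN_I) auto

text \<open>
  Clearing denominators and evaluating at \<open>z = 1\<close> turns the determinant into a polynomial function
  of the parameters.  It does not vanish when the gains are 1 on the paths and 0 elsewhere.
\<close>

lemma AE_inputs_observable:
  fixes D :: "'n::finite pair_pre_digraph"
  assumes "vertex_disjoint_paths D A B"
  shows "AE P in Pi\<^sub>M (params D n) (\<lambda>_. lborel).
           inputs_observable (mat 1 - parametrized_matrix D d n P) A B"
proof -
  obtain \<pi> where \<pi>: "\<And>a. a \<in> A \<Longrightarrow> vpath (\<pi> a) (with_proj D) \<and> hd (\<pi> a) = a \<and> last (\<pi> a) \<in> B"
    and disj: "disjoint_family_on (\<lambda>a. set (\<pi> a)) A"
    using assms unfolding vertex_disjoint_paths_def by blast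
  define \<sigma> where "\<sigma> a = last (\<pi> a)" for a
  define F where "F = {(k, j). \<exists>a\<in>A. \<exists>m. Suc m < length (\<pi> a) \<and> k = \<pi> a ! m \<and> j = \<pi> a ! Suc m}"
  have FE: "F \<subseteq> parcs D"
    using \<pi> vwalk_arcs_nth by (fastforce simp: F_def vpath_def vwalk_def)
  define num where "num P e = smult (P (Gain e)) (monic_poly (n e) (\<lambda>m. P (Num_Coeff e m)))"
    for P :: "'n param \<Rightarrow> real" and e
  define den where "den P e = monom 1 (d e) * monic_poly (n e) (\<lambda>m. P (Den_Coeff e m))"
    for P :: "'n param \<Rightarrow> real" and e
  define Q where "Q P = (\<Prod>e\<in>parcs D. den P e)" for P
  \<comment> \<open>This is \<open>Q P\<close> times
    \<open>mat 1 - parametrized_matrix D d n P\<close>, with the fractions cancelled.\<close>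
  define K where "K P = (\<chi> j k. (if j = k then Q P else 0) -
    (if (k, j) \<in> parcs D then num P (k, j) * (\<Prod>e\<in>parcs D - {(k, j)}. den P e) else 0))" for P
  define M where "M P = replace_rows A \<sigma> (K P)" for P
  define f where "f P = det (\<chi> j k. poly (M P $ j $ k) 1)" for P
  have den1: "polynomial_on (params D n) (\<lambda>P. poly (den P e) 1)" if "e \<in> parcs D" for e
    unfolding den_def poly_mult poly_monom poly_monic_poly_1
    by (intro polynomial_on.intros polynomial_on_sum) (use that in \<open>auto simp: params_def\<close>)
  have num1: "polynomial_on (params D n) (\<lambda>P. poly (num P e) 1)" if "e \<in> parcs D" for e
    unfolding num_def poly_smult poly_monic_poly_1
    by (intro polynomial_on.intros polynomial_on_sum) (use that in \<open>auto simp: params_def\<close>)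
  have Q1: "polynomial_on (params D n) (\<lambda>P. poly (Q P) 1)"
    unfolding Q_def poly_prod by (intro polynomial_on_prod den1)
  have "polynomial_on (params D n) (\<lambda>P. poly (M P $ j $ k) 1)" for j k
  proof (cases "j \<in> A")
    case True
    then show ?thesis
      by (simp add: M_def replace_rows_def polynomial_on.const)
  next
    case False
    have "polynomial_on (params D n) (\<lambda>P. poly (if j = k then Q P else 0) 1)"
      using Q1 by (cases "j = k") (simp_all add: polynomial_on.const)
    moreover have "polynomial_on (params D n) (\<lambda>P. poly (if (k, j) \<in> parcs D
        then num P (k, j) * (\<Prod>e\<in>parcs D - {(k, j)}. den P e) else 0) 1)"
      by (cases "(k, j) \<in> parcs D")
        (auto simp: poly_prod intro!: polynomial_on.intros num1 den1 polynomial_on_prod)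
    ultimately show ?thesis
      using False by (simp add: M_def replace_rows_def K_def polynomial_on_diff)
  qed
  then have f: "polynomial_on (params D n) f"
    unfolding f_def by (intro polynomial_on_det) simp
  \<comment> \<open>Zero coefficients reduce the monic polynomials to powers of z, with value 1 at z
    = 1; the gains then leave only the path edges.\<close>
  define P0 :: "'n param \<Rightarrow> real"
    where "P0 x = (case x of Gain e \<Rightarrow> if e \<in> F then 1 else 0 | _ \<Rightarrow> 0)" for x
  have at_P0: "poly (num P0 e) 1 = (if e \<in> F then 1 else 0)" "poly (den P0 e) 1 = 1"
    "poly (Q P0) 1 = 1" for e
    by (simp_all add: num_def den_def Q_def P0_def poly_monic_poly_1 poly_monom poly_prod)
  have "(\<chi> j k. poly (M P0 $ j $ k) 1) =
    replace_rows A \<sigma> (mat 1 - (\<chi> j k. if (k, j) \<in> F then 1 else 0))"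
    using FE by (auto simp: vec_eq_iff M_def K_def replace_rows_def mat_def at_P0 poly_prod)
  moreover have "\<pi> a \<noteq> [] \<and> distinct (\<pi> a) \<and> hd (\<pi> a) = a" if "a \<in> A" for a
    using \<pi>[OF that] by (auto simp: vpath_def vwalk_def)
  then have "det (replace_rows A \<sigma> (mat 1 - (\<chi> j k. if (k, j) \<in> F then 1 else 0)) :: real ^ 'n ^ 'n) \<noteq> 0"
    unfolding \<sigma>_def by (intro det_disjoint_paths_nz disj F_def) auto
  ultimately have "f P0 \<noteq> 0"
    by (simp add: f_def)
  from polynomial_on_AE_nonzero[OF finite_params f this] show ?thesis
  proof eventually_elim
    case (elim P)
    have "f P = poly (det (M P)) 1"
      unfolding f_def by (rule det_ring_hom) auto
    with elim have "det (M P) \<noteq> 0" by auto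
    \<comment> \<open>The kernel criterion needs a field, hence the passage to fractions.\<close>
    then have "det (\<chi> j k. to_fract (M P $ j $ k)) \<noteq> 0"
      by (subst det_ring_hom) auto
    moreover have "(\<chi> j k. to_fract (M P $ j $ k)) =
      replace_rows A \<sigma> (\<chi> j k. to_fract (K P $ j $ k))"
      by (auto simp: vec_eq_iff M_def replace_rows_def)
    ultimately have "inputs_observable (\<chi> j k. to_fract (K P $ j $ k)) A B"
      using inputs_observable_if_det_nz[of \<sigma> A B] \<pi> by (auto simp: \<sigma>_def)
    moreover have "to_fract (K P $ j $ k) =
      to_fract (Q P) * (mat 1 - parametrized_matrix D d n P) $ j $ k" for j k
    proof -
      have "to_fract (num P e * (\<Prod>e\<in>parcs D - {e}. den P e)) =
        to_fract (Q P) * (to_fract (num P e) / to_fract (den P e))" if "e \<in> parcs D" for e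
      proof -
        have "Q P = den P e * (\<Prod>e\<in>parcs D - {e}. den P e)"
          unfolding Q_def using that by (intro prod.remove) auto
        moreover have "den P e \<noteq> 0"
          by (simp add: den_def monic_poly_nz)
        ultimately show ?thesis by simp
      qed
      moreover have "parametrized_matrix D d n P $ j $ k =
        (if (k, j) \<in> parcs D then to_fract (num P (k, j)) / to_fract (den P (k, j)) else 0)"
      proof -
        have "num P (k, j) = [:P (Gain (k, j)):] * monic_poly (n (k, j)) (\<lambda>m. P (Num_Coeff (k, j) m))"
          by (simp add: num_def)
        then show ?thesis
          by (simp only: parametrized_matrix_def den_def Fract_conv_to_fract to_fract_mult Let_def
              vec_lambda_beta times_divide_times_eq)
      qed
      ultimately show ?thesis
        by (simp add: K_def mat_def algebra_simps)
    qed
    ultimately show ?case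
      using inputs_observable_scale[of "\<chi> j k. to_fract (K P $ j $ k)" A B "to_fract (Q P)"]
      by (simp only: vec_lambda_beta)
  qed
qed

text \<open>The measure is not null: the unit cube has measure 1.\<close>

lemma AE_lborel_PiM_ex:
  assumes "finite S" "AE P in Pi\<^sub>M S (\<lambda>_. lborel :: real measure). Q P"
  shows "\<exists>P. Q P"
proof (rule ccontr)
  interpret product_sigma_finite "\<lambda>_::'a. lborel :: real measure"
    by standard
  let ?M = "Pi\<^sub>M S (\<lambda>_. lborel :: real measure)"
  let ?U = "Pi\<^sub>E S (\<lambda>_. {0..1::real})"
  assume "\<nexists>P. Q P"
  with assms(2) have "AE P in ?M. P \<notin> ?U"
    by (auto elim: eventually_mono)
  moreover have "?U \<in> sets ?M"
    using assms(1) by (intro sets_PiM_I_finite) auto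
  ultimately have "emeasure ?M ?U = 0"
    by (subst (asm) AE_iff_measurable[of ?U]) (auto dest: sets.sets_into_space)
  moreover have "emeasure ?M ?U = 1"
    using assms(1) by (subst emeasure_PiM) auto
  ultimately show False by simp
qed

subsection \<open>Matrix inverses and constant networks\<close>

lemma matrix_inv_inverse:
  fixes K :: "'a::semiring_1 ^ 'n ^ 'n"
  assumes "invertible K"
  shows "K ** matrix_inv K = mat 1" "matrix_inv K ** K = mat 1"
  using someI_ex[OF assms[unfolded invertible_def]] by (auto simp: matrix_inv_def)

text \<open>Eliminates the inverse of \<open>K'\<close>, making the equality of measurements linear
  in the candidate network.\<close>

lemma mult_matrix_inv_eq_iff:
  fixes K K' :: "'a::semiring_1 ^ 'n ^ 'n"
  assumes "invertible K" "invertible K'"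
  shows "C ** matrix_inv K = C ** matrix_inv K' \<longleftrightarrow> C ** matrix_inv K ** K' = C"
proof
  assume "C ** matrix_inv K = C ** matrix_inv K'"
  then show "C ** matrix_inv K ** K' = C"
    using matrix_inv_inverse[OF assms(2)] by (simp flip: matrix_mul_assoc)
next
  assume "C ** matrix_inv K ** K' = C"
  then have "C ** matrix_inv K ** K' ** matrix_inv K' = C ** matrix_inv K'"
    by simp
  then show "C ** matrix_inv K = C ** matrix_inv K'"
    using matrix_inv_inverse[OF assms(2)] by (simp flip: matrix_mul_assoc)
qed

lemma to_fract_const:
  fixes a b :: "'a::idom"
  shows "to_fract [:1::'a:] = 1"
    and "to_fract [:a + b:] = to_fract [:a:] + to_fract [:b:]"
    and "to_fract [:a - b:] = to_fract [:a:] - to_fract [:b:]"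
    and "to_fract [:a * b:] = to_fract [:a:] * to_fract [:b:]"
  by (metis one_pCons to_fract_1) (simp_all flip: to_fract_add to_fract_diff to_fract_mult)

definition const_matrix :: "real ^ 'n ^ 'm \<Rightarrow> transfer_function ^ 'n ^ 'm" where
  "const_matrix M = (\<chi> i j. to_fract [:M $ i $ j:])"

lemma const_matrix_nth: "const_matrix M $ i $ j = to_fract [:M $ i $ j:]"
  by (simp add: const_matrix_def)

lemma const_matrix_mat_1: "const_matrix (mat 1) = mat 1"
  by (auto simp: vec_eq_iff const_matrix_nth mat_def to_fract_const)

lemma const_matrix_diff: "const_matrix (M - N) = const_matrix M - const_matrix N"
  by (simp add: vec_eq_iff const_matrix_nth to_fract_const)

lemma const_matrix_mult: "const_matrix (M ** N) = const_matrix M ** const_matrix N"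
proof -
  have "to_fract [:sum f S:] = (\<Sum>k\<in>S. to_fract [:f k:])" for f :: "'c \<Rightarrow> real" and S
    by (induction S rule: infinite_finite_induct) (simp_all add: to_fract_const)
  then show ?thesis
    by (simp add: vec_eq_iff const_matrix_nth matrix_matrix_mult_def to_fract_const)
qed

lemma invertible_const_matrix_iff:
  fixes M :: "real ^ 'n::finite ^ 'n"
  shows "invertible (const_matrix M) \<longleftrightarrow> invertible M"
proof -
  have "det (const_matrix M) = to_fract [:det M:]"
    unfolding const_matrix_def
    by (rule det_ring_hom) (simp_all add: to_fract_const)
  then show ?thesis
    by (simp add: invertible_det_nz)
qed

lemma proper_const: "proper (to_fract [:r:])"
  by (simp add: proper_def)

lemma stable_const: "stable (to_fract [:r:])"
  by (simp add: stable_def)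

lemma well_posed_const_matrix:
  fixes M :: "real ^ 'n::finite ^ 'n"
  assumes "invertible (mat 1 - M)"
  shows "well_posed (const_matrix M)"
proof -
  let ?K = "mat 1 - const_matrix M"
  have K: "?K = const_matrix (mat 1 - M)"
    by (simp add: const_matrix_diff const_matrix_mat_1)
  then have inv: "invertible ?K"
    using assms by (simp add: invertible_const_matrix_iff)
  \<comment> \<open>Uniqueness of inverses identifies \<open>matrix_inv ?K\<close> with a constant
    matrix, whose entries have no poles.\<close>
  have "matrix_inv ?K = matrix_inv ?K ** (?K ** const_matrix (matrix_inv (mat 1 - M)))"
    unfolding K by (simp add: matrix_inv_inverse[OF assms] const_matrix_mat_1 flip: const_matrix_mult)
  also have "\<dots> = const_matrix (matrix_inv (mat 1 - M))"
    using matrix_inv_inverse[OF inv] by (simp add: matrix_mul_assoc)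
  finally show ?thesis
    using inv by (simp add: well_posed_def const_matrix_nth proper_const stable_const)
qed

subsection \<open>Identifiability\<close>

lemma selection_matrix_row:
  assumes "selection_matrix C"
  obtains b where "b \<in> measured_nodes C" "\<And>j. C $ r $ j = (if j = b then 1 else 0)"
proof -
  obtain b where b: "\<And>j. C $ r $ j = (if j = b then 1 else 0)"
    using assms by (auto simp: selection_matrix_def)
  then have "C $ r $ b = 1" by simp
  then have "b \<in> measured_nodes C"
    unfolding measured_nodes_def by blast
  with b show thesis by (rule that[rotated])
qed

lemma selection_matrix_kernel:
  assumes "selection_matrix C" "C *v u = 0" "b \<in> measured_nodes C"
  shows "u $ b = 0"
proof -
  obtain r where r: "C $ r $ b = 1"
    using assms(3) by (auto simp: measured_nodes_def)
  obtain b' where b': "\<And>j. C $ r $ j = (if j = b' then 1 else 0)"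
    using selection_matrix_row[OF assms(1), of r] by blast
  from r b'[of b] have "b' = b" by (auto split: if_splits)
  then have "(C *v u) $ r = (\<Sum>j\<in>UNIV. if j = b then u $ j else 0)"
    unfolding matrix_vector_mult_def vec_lambda_beta by (intro sum.cong) (simp_all add: b')
  with assms(2) show ?thesis by simp
qed

lemma vertex_disjoint_paths_empty: "vertex_disjoint_paths D {} B"
  by (simp add: vertex_disjoint_paths_def disjoint_family_on_def)

text \<open>Column \<open>i\<close> of the difference of two indistinguishable networks is an input
  on the out-neighbours that is invisible at the measured nodes; generic observability makes it
  0.\<close>

lemma generically_identifiable_if_disjoint_paths:
  fixes D :: "'n::finite pair_pre_digraph"
  assumes C: "selection_matrix C"
    and inv: "\<And>G. G \<in> \<G> \<Longrightarrow> invertible (mat 1 - G)"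
    and paths: "vertex_disjoint_paths D (out_neighbours D i) (measured_nodes C)"
  shows "generically_identifiable \<G> D C {(i, j) | j. j \<in> out_neighbours D i}"
  unfolding generically_identifiable_def
proof (intro allI)
  fix d n
  let ?G = "parametrized_matrix D d n"
  show "AE P in Pi\<^sub>M (params D n) (\<lambda>_. lborel). \<forall>G'\<in>\<G>. consistent D G' \<longrightarrow>
    C ** matrix_inv (mat 1 - ?G P) = C ** matrix_inv (mat 1 - G') \<longrightarrow>
    (\<forall>(i, j)\<in>{(i, j) | j. j \<in> out_neighbours D i}. ?G P $ j $ i = G' $ j $ i)"
    using AE_inputs_observable[where n = n and d = d, OF paths]
      AE_inputs_observable[where n = n and d = d, OF vertex_disjoint_paths_empty[where B = "{}"]]
  proof eventually_elim
    case (elim P)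
    let ?K = "mat 1 - ?G P"
    have K: "invertible ?K"
      using elim(2) by (rule invertible_if_inputs_observable_empty)
    have "?G P $ j $ i = G' $ j $ i"
      if G': "G' \<in> \<G>" "consistent D G'" and eq: "C ** matrix_inv ?K = C ** matrix_inv (mat 1 - G')"
      for G' j
    proof -
      define x where "x = (?G P - G') *v axis i 1"
      define u where "u = matrix_inv ?K *v x"
      have x_nth: "x $ j = ?G P $ j $ i - G' $ j $ i" for j
        by (simp add: x_def matrix_vector_mult_def axis_def if_distrib cong: if_cong)
      have "C ** matrix_inv ?K ** (mat 1 - G') = C"
        using mult_matrix_inv_eq_iff[OF K inv[OF G'(1)]] eq by blast
      moreover have "C ** matrix_inv ?K ** ?K = C"
        using matrix_inv_inverse[OF K] by (simp flip: matrix_mul_assoc)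
      \<comment> \<open>\<open>C ** matrix_inv ?K\<close> maps both terms to
        \<open>C *v axis i 1\<close>.\<close>
      moreover have "x = (mat 1 - G') *v axis i 1 - ?K *v axis i 1"
        by (simp add: x_def matrix_vector_mult_diff_rdistrib)
      ultimately have "(C ** matrix_inv ?K) *v x = 0"
        by (simp add: matrix_vector_mult_diff_distrib matrix_vector_mul_assoc)
      then have "C *v u = 0"
        by (simp add: u_def matrix_vector_mul_assoc)
      then have "\<forall>b\<in>measured_nodes C. u $ b = 0"
        using selection_matrix_kernel[OF C] by blast
      moreover have Ku: "?K *v u = x"
        using matrix_inv_inverse[OF K] by (simp add: u_def matrix_vector_mul_assoc)
      moreover have "x $ j = 0" if "j \<notin> out_neighbours D i" for j
        using that G'(2)
        by (auto simp: x_nth out_neighbours_def consistent_def parametrized_matrix_def)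
      ultimately have "u = 0"
        using elim(1) unfolding inputs_observable_def by blast
      with Ku have "x = 0" by simp
      then show ?thesis
        using x_nth[of j] by simp
    qed
    then show ?case by blast
  qed
qed

text \<open>
  With \<open>T = (I - G)\<inverse>\<close>, an unobservable input \<open>x\<close> yields, for any \<open>t \<noteq> 0\<close> keeping \<open>I - G'\<close>
  invertible, an indistinguishable network \<open>G' = G + t x e\<^sub>i\<^sup>T\<close>, since
  \<open>I - G' = (I - G) (I - t u e\<^sub>i\<^sup>T)\<close> for \<open>u = T x\<close>, and \<open>C u = 0\<close>.
\<close>

lemma ex_indistinguishable:
  fixes G :: "real ^ 'n::finite ^ 'n"
  assumes C: "selection_matrix C"
    and K: "invertible (mat 1 - G)"
    and not_obs: "\<not> inputs_observable (mat 1 - G) A (measured_nodes C)"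
  obtains G' j where "invertible (mat 1 - G')"
    "C ** matrix_inv (mat 1 - const_matrix G) = C ** matrix_inv (mat 1 - const_matrix G')"
    "\<And>j k. j \<notin> A \<or> k \<noteq> i \<Longrightarrow> G' $ j $ k = G $ j $ k"
    "j \<in> A" "G' $ j $ i \<noteq> G $ j $ i"
proof -
  let ?K = "mat 1 - G"
  obtain u where off: "\<And>j. j \<notin> A \<Longrightarrow> (?K *v u) $ j = 0"
    and meas: "\<And>b. b \<in> measured_nodes C \<Longrightarrow> u $ b = 0" and u: "u \<noteq> 0"
    using not_obs unfolding inputs_observable_def by blast
  \<comment> \<open>The rank-one change is singular exactly when
    \<open>t * u $ i = 1\<close>.\<close>
  define t :: real where "t = (if u $ i = 1 then 2 else 1)"
  have t: "t \<noteq> 0" "t * u $ i \<noteq> 1"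
    by (auto simp: t_def)
  define W :: "real ^ 'n ^ 'n" where "W = mat 1 - (\<chi> j k. if k = i then t * u $ j else 0)"
  define G' where "G' = G + (\<chi> j k. if k = i then t * (?K *v u) $ j else 0)"
  \<comment> \<open>\<open>W *v y = 0\<close> makes \<open>y\<close> the multiple
    \<open>t * y $ i\<close> of \<open>u\<close>; entry \<open>i\<close> then forces
    \<open>y $ i = 0\<close>.\<close>
  have "y = 0" if "W *v y = 0" for y
  proof -
    have y: "y $ j = t * u $ j * y $ i" for j
    proof -
      have "((\<chi> j k. if k = i then t * u $ j else 0) *v y) $ j =
        (\<Sum>k\<in>UNIV. if k = i then t * u $ j * y $ k else 0)"
        unfolding matrix_vector_mult_def vec_lambda_beta by (intro sum.cong) simp_all
      moreover have "(W *v y) $ j = 0" using that by simp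
      ultimately show ?thesis
        by (simp add: W_def matrix_vector_mult_diff_rdistrib)
    qed
    from y[of i] t(2) have "y $ i = 0" by simp
    with y show ?thesis by (simp add: vec_eq_iff)
  qed
  then have W: "invertible W"
    using det_nz_iff_kernel invertible_det_nz by blast
  have "?K ** (\<chi> j k. if k = i then t * u $ j else 0) =
    (\<chi> j k. if k = i then t * (?K *v u) $ j else 0)"
    by (auto simp: vec_eq_iff matrix_matrix_mult_def matrix_vector_mult_def sum_distrib_left ac_simps)
  moreover have "?K ** (mat 1 - X) = ?K - ?K ** X" for X
    using matrix_add_ldistrib[of ?K "mat 1 - X" X] by (simp add: eq_diff_eq)
  ultimately have fact: "mat 1 - G' = ?K ** W"
    by (simp add: W_def G'_def)
  have K': "invertible (mat 1 - G')"
    unfolding fact using K W by (rule invertible_mult)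
  have const: "mat 1 - const_matrix M = const_matrix (mat 1 - M)" for M :: "real ^ 'n ^ 'n"
    by (simp add: const_matrix_diff const_matrix_mat_1)
  \<comment> \<open>\<open>W\<close> differs from the identity by a multiple of \<open>u\<close> in
    column \<open>i\<close>, and \<open>u\<close> vanishes at the measured nodes.\<close>
  have CW: "C ** const_matrix W = C"
  proof -
    have "(C ** const_matrix W) $ r $ k = C $ r $ k" for r k
    proof -
      obtain b where b: "b \<in> measured_nodes C" "\<And>j. C $ r $ j = (if j = b then 1 else 0)"
        using selection_matrix_row[OF C, of r] by blast
      have "(C ** const_matrix W) $ r $ k =
        (\<Sum>j\<in>UNIV. if j = b then const_matrix W $ j $ k else 0)"
        unfolding matrix_matrix_mult_def vec_lambda_beta by (intro sum.cong) (simp_all add: b(2))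
      also have "\<dots> = C $ r $ k"
        using meas[OF b(1)] by (auto simp: const_matrix_nth W_def mat_def b(2) to_fract_const)
      finally show ?thesis .
    qed
    then show ?thesis by (simp add: vec_eq_iff)
  qed
  have invs: "invertible (const_matrix ?K)" "invertible (const_matrix (mat 1 - G'))"
    using K K' by (simp_all add: invertible_const_matrix_iff)
  have "C ** matrix_inv (const_matrix ?K) ** const_matrix (mat 1 - G') =
    C ** (matrix_inv (const_matrix ?K) ** const_matrix ?K) ** const_matrix W"
    by (simp add: fact const_matrix_mult matrix_mul_assoc)
  also have "\<dots> = C"
    using matrix_inv_inverse[OF invs(1)] CW by simp
  finally have same: "C ** matrix_inv (mat 1 - const_matrix G) = C ** matrix_inv (mat 1 - const_matrix G')"
    unfolding const using mult_matrix_inv_eq_iff[OF invs] by blast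
  \<comment> \<open>Invertibility ensures that some entry of column \<open>i\<close> really
    changes.\<close>
  have "?K *v u \<noteq> 0"
    using K u by (metis det_nz_iff_kernel invertible_det_nz)
  then obtain j where j: "(?K *v u) $ j \<noteq> 0"
    by (auto simp: vec_eq_iff)
  show thesis
  proof (rule that[OF K' same])
    show "G' $ j $ k = G $ j $ k" if "j \<notin> A \<or> k \<noteq> i" for j k
      using that off by (auto simp: G'_def)
    show "j \<in> A" using j off by blast
    show "G' $ j $ i \<noteq> G $ j $ i" using j t(1) by (simp add: G'_def)
  qed
qed

text \<open>At one good parameter vector, an unobservable input would produce a second constant
  network in \<open>\<G>\<close> with the same measurements. Hence observability holds there, and
  the determinant yields the paths.\<close>

lemma disjoint_paths_if_generically_identifiable:
  fixes D :: "'n::finite pair_pre_digraph"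
  assumes D: "network_graph D" and C: "selection_matrix C"
    and \<G>: "\<And>G. network_matrix G \<Longrightarrow> well_posed G \<Longrightarrow> G \<in> \<G>"
    and ident: "generically_identifiable \<G> D C {(i, j) | j. j \<in> out_neighbours D i}"
  shows "vertex_disjoint_paths D (out_neighbours D i) (measured_nodes C)"
proof -
  let ?A = "out_neighbours D i"
  \<comment> \<open>With delays and orders 0 every edge carries just its gain.\<close>
  let ?p = "parametrized_matrix D (\<lambda>_. 0) (\<lambda>_. 0)"
  have loopfree: "(j, j) \<notin> parcs D" for j
    using D by (auto simp: network_graph_def pair_digraph_def pair_loopfree_digraph_def
        pair_loopfree_digraph_axioms_def)
  have "AE P in Pi\<^sub>M (params D (\<lambda>_. 0)) (\<lambda>_. lborel).
    (\<forall>G'\<in>\<G>. consistent D G' \<longrightarrow>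
      C ** matrix_inv (mat 1 - ?p P) = C ** matrix_inv (mat 1 - G') \<longrightarrow>
      (\<forall>j\<in>?A. ?p P $ j $ i = G' $ j $ i)) \<and> inputs_observable (mat 1 - ?p P) {} {}"
    using ident[unfolded generically_identifiable_def, rule_format, of "\<lambda>_. 0" "\<lambda>_. 0"]
      AE_inputs_observable[OF vertex_disjoint_paths_empty[where B = "{}"]]
    by eventually_elim blast
  from AE_lborel_PiM_ex[OF finite_params this] obtain P where
    P: "\<And>G' j. G' \<in> \<G> \<Longrightarrow> consistent D G' \<Longrightarrow>
      C ** matrix_inv (mat 1 - ?p P) = C ** matrix_inv (mat 1 - G') \<Longrightarrow> j \<in> ?A \<Longrightarrow>
      ?p P $ j $ i = G' $ j $ i"
    and inv: "inputs_observable (mat 1 - ?p P) {} {}"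
    by blast
  define G :: "real ^ 'n ^ 'n" where "G = (\<chi> j k. if (k, j) \<in> parcs D then P (Gain (k, j)) else 0)"
  have p: "?p P = const_matrix G"
    by (auto simp: vec_eq_iff parametrized_matrix_def const_matrix_nth G_def monic_poly_def
        Fract_conv_to_fract simp flip: to_fract_mult)
  have "invertible (mat 1 - const_matrix G)"
    using inv invertible_if_inputs_observable_empty unfolding p by blast
  then have K: "invertible (mat 1 - G)"
    by (simp add: invertible_const_matrix_iff flip: const_matrix_diff const_matrix_mat_1)
  have "inputs_observable (mat 1 - G) ?A (measured_nodes C)"
  proof (rule ccontr)
    assume "\<not> inputs_observable (mat 1 - G) ?A (measured_nodes C)"
    then obtain G' j where G': "invertible (mat 1 - G')"
      "C ** matrix_inv (mat 1 - const_matrix G) = C ** matrix_inv (mat 1 - const_matrix G')"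
      and agree: "\<And>j k. j \<notin> ?A \<or> k \<noteq> i \<Longrightarrow> G' $ j $ k = G $ j $ k"
      and j: "j \<in> ?A" "G' $ j $ i \<noteq> G $ j $ i"
      using ex_indistinguishable[OF C K, of ?A i] by metis
    \<comment> \<open>Only entries of edges leaving \<open>i\<close> differ from \<open>G\<close>,
      so the zero pattern survives.\<close>
    have supp: "G' $ j $ k = 0" if "(k, j) \<notin> parcs D" for j k
      using agree[of j k] that by (auto simp: out_neighbours_def G_def)
    have "network_matrix (const_matrix G')"
      using supp loopfree by (simp add: network_matrix_def const_matrix_nth proper_const)
    moreover have "consistent D (const_matrix G')"
      using supp by (auto simp: consistent_def const_matrix_nth)
    ultimately have "const_matrix G $ j $ i = const_matrix G' $ j $ i"
      using P[of "const_matrix G'" j] \<G> well_posed_const_matrix[OF G'(1)] G'(2) j(1)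
      unfolding p by blast
    with j(2) show False
      by (simp add: const_matrix_nth)
  qed
  with K obtain \<sigma> where \<sigma>: "\<sigma> ` ?A \<subseteq> measured_nodes C" "det (replace_rows ?A \<sigma> (mat 1 - G)) \<noteq> 0"
    by (rule ex_replace_rows_det_nz)
  show ?thesis
  proof (rule vertex_disjoint_paths_if_det_nz[OF _ _ \<sigma>(2,1)])
    show "pverts D = UNIV"
      using D by (simp add: network_graph_def)
    show "(k, j) \<in> parcs D" if "G $ j $ k \<noteq> 0" for j k
      using that by (auto simp: G_def split: if_splits)
  qed
qed

theorem corollaryV2:
  fixes D :: "'n::finite pair_pre_digraph"
    and G0 :: "'n transfer_matrix"
    and C :: "transfer_function ^ 'n ^ 'p::finite"
    and \<G> :: "'n transfer_matrix set"
    and i :: 'n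
  assumes "network_graph D"
    and "network_matrix G0" and "well_posed G0" and "consistent D G0"
    and "selection_matrix C"
    and "\<G> = {G. network_matrix G \<and> invertible (mat 1 - G)} \<or>
         \<G> = {G. network_matrix G \<and> well_posed G}"
  shows "generically_identifiable \<G> D C {(i, j) | j. j \<in> out_neighbours D i} \<longleftrightarrow>
         vertex_disjoint_paths D (out_neighbours D i) (measured_nodes C)"
proof
  assume "generically_identifiable \<G> D C {(i, j) | j. j \<in> out_neighbours D i}"
  \<comment> \<open>Well-posedness includes invertibility, so both choices of \<open>\<G>\<close>
    contain all well-posed networks.\<close>
  with assms show "vertex_disjoint_paths D (out_neighbours D i) (measured_nodes C)"
    by (intro disjoint_paths_if_generically_identifiable[of D C \<G>]) (auto simp: well_posed_def)
next
  assume "vertex_disjoint_paths D (out_neighbours D i) (measured_nodes C)"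
  with assms show "generically_identifiable \<G> D C {(i, j) | j. j \<in> out_neighbours D i}"
    by (intro generically_identifiable_if_disjoint_paths) (auto simp: well_posed_def)
qed

end
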